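(* Let $p$ be a prime, $D=\{0,1,\dots,p-1\}$, and $f(x,y,z)=x-y+z \pmod p$. Then for any set of relations $\Gamma$ over $D$ with $\langle\Gamma\rangle\subseteq\mathrm{Inv}(f)$, the co-clone $\langle\Gamma\rangle$ is $\exists!$-covered.
   Context: Relations over $D$ are subsets of $D^n$; $\mathrm{Eq}_D=\{(d,d)\mid d\in D\}$. An operation $g\colon D^k\to D$ preserves an $n$-ary relation $R$ if applying $g$ coordinatewise to any $k$ tuples of $R$ gives a tuple of $R$; $\mathrm{Inv}(f)$ is the set of relations preserved by $f$. A pp-definition of an $n$-ary relation $R$ over $\Gamma$ is a formula $R(x_1,\dots,x_n)\equiv\exists y_1,\dots,y_m\colon R_1(\mathbf{x}_1)\wedge\dots\wedge R_k(\mathbf{x}_k)$ with $R_j\in\Gamma\cup\{\mathrm{Eq}_D\}$ and each $\mathbf{x}_j$ a tuple of variables among $x_1,\dots,x_n,y_1,\dots,y_m$; $\langle\Gamma\rangle$ is the set of pp-definable relations (a co-clone); $\Delta$ is a base of a co-clone $C$ if $\langle\Delta\rangle=C$. A upp-definition is a pp-definition in which each $y_j$ is uniquely determined by $x_1,\dots,x_n$ (there is $h_j\colon D^n\to D$ such that every satisfying assignment of the conjunction gives $y_j$ the value $h_j$ of the values of $x_1,\dots,x_n$); $\langle\Delta\rangle_{\exists!}$ is the set of upp-definable relations. A co-clone $C$ is $\exists!$-covered if $\langle\Delta\rangle_{\exists!}=C$ for every base $\Delta$ of $C$. *)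

theory Defs
  imports "HOL-Library.NList" "HOL-Library.FuncSet" "HOL-Computational_Algebra.Primes"
begin

text \<open>
  The set \<open>D\<^sup>n\<close> is \<^term>\<open>nlists n D\<close>. An \<open>n\<close>-ary relation \<open>R \<subseteq> D\<^sup>n\<close> is the pair \<open>(n, R)\<close>, so that
  empty relations of different arities are distinguished. Arity \<open>0\<close> is allowed.
\<close>

type_synonym 'a nrel = "nat \<times> 'a list set"

definition relations :: "'a set \<Rightarrow> 'a nrel set" where
  "relations D = {(n, R). R \<subseteq> nlists n D}"

definition Eq_rel :: "'a set \<Rightarrow> 'a nrel" where
  "Eq_rel D = (2, {[d, d] | d. d \<in> D})"

text \<open>A \<open>k\<close>-ary operation on \<open>D\<close> is a function on lists, of which only the values on
  \<^term>\<open>nlists k D\<close> matter.\<close>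

definition preserves :: "nat \<Rightarrow> ('a list \<Rightarrow> 'a) \<Rightarrow> 'a nrel \<Rightarrow> bool" where
  "preserves k g r \<longleftrightarrow>
     (\<forall>ts \<in> nlists k (snd r). map (\<lambda>i. g (map (\<lambda>t. t ! i) ts)) [0..<fst r] \<in> snd r)"

definition Inv :: "'a set \<Rightarrow> nat \<Rightarrow> ('a list \<Rightarrow> 'a) \<Rightarrow> 'a nrel set" where
  "Inv D k g = {r \<in> relations D. preserves k g r}"

text \<open>
  An atom \<open>R(z\<^sub>1, \<dots>, z\<^sub>l)\<close> is a relation together with a list of variables; a conjunction is a
  (possibly empty) list of atoms. Variables are numbered: in a formula with free variables
  \<open>x\<^sub>1, \<dots>, x\<^sub>n\<close> and quantified variables \<open>y\<^sub>1, \<dots>, y\<^sub>m\<close>, the indices below \<open>n\<close> stand for the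
  former and the indices \<open>n, \<dots>, n + m - 1\<close> for the latter.
\<close>

type_synonym 'a atom = "'a nrel \<times> nat list"

definition conj_over :: "'a set \<Rightarrow> 'a nrel set \<Rightarrow> nat \<Rightarrow> 'a atom list \<Rightarrow> bool" where
  "conj_over D \<Gamma> N \<phi> \<longleftrightarrow>
     (\<forall>(r, vs) \<in> set \<phi>. r \<in> \<Gamma> \<union> {Eq_rel D} \<and> length vs = fst r \<and> set vs \<subseteq> {..<N})"

definition satisfies :: "'a list \<Rightarrow> 'a atom list \<Rightarrow> bool" where
  "satisfies s \<phi> \<longleftrightarrow> (\<forall>(r, vs) \<in> set \<phi>. map (\<lambda>v. s ! v) vs \<in> snd r)"

definition pp_definition :: "'a set \<Rightarrow> 'a nrel set \<Rightarrow> 'a nrel \<Rightarrow> nat \<Rightarrow> 'a atom list \<Rightarrow> bool" where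
  "pp_definition D \<Gamma> r m \<phi> \<longleftrightarrow>
     conj_over D \<Gamma> (fst r + m) \<phi> \<and>
     snd r = {xs \<in> nlists (fst r) D. \<exists>ys \<in> nlists m D. satisfies (xs @ ys) \<phi>}"

definition upp_definition :: "'a set \<Rightarrow> 'a nrel set \<Rightarrow> 'a nrel \<Rightarrow> nat \<Rightarrow> 'a atom list \<Rightarrow> bool" where
  "upp_definition D \<Gamma> r m \<phi> \<longleftrightarrow>
     pp_definition D \<Gamma> r m \<phi> \<and>
     (\<forall>j < m. \<exists>h \<in> nlists (fst r) D \<rightarrow> D.
        \<forall>xs \<in> nlists (fst r) D. \<forall>ys \<in> nlists m D. satisfies (xs @ ys) \<phi> \<longrightarrow> ys ! j = h xs)"

definition pp_closure :: "'a set \<Rightarrow> 'a nrel set \<Rightarrow> 'a nrel set" where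
  "pp_closure D \<Gamma> = {r. \<exists>m \<phi>. pp_definition D \<Gamma> r m \<phi>}"

definition upp_closure :: "'a set \<Rightarrow> 'a nrel set \<Rightarrow> 'a nrel set" where
  "upp_closure D \<Gamma> = {r. \<exists>m \<phi>. upp_definition D \<Gamma> r m \<phi>}"

definition is_base :: "'a set \<Rightarrow> 'a nrel set \<Rightarrow> 'a nrel set \<Rightarrow> bool" where
  "is_base D \<Delta> C \<longleftrightarrow> \<Delta> \<subseteq> relations D \<and> pp_closure D \<Delta> = C"

definition co_clone :: "'a set \<Rightarrow> 'a nrel set \<Rightarrow> bool" where
  "co_clone D C \<longleftrightarrow> (\<exists>\<Gamma> \<subseteq> relations D. C = pp_closure D \<Gamma>)"

definition uniquely_covered :: "'a set \<Rightarrow> 'a nrel set \<Rightarrow> bool" where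
  "uniquely_covered D C \<longleftrightarrow> co_clone D C \<and> (\<forall>\<Delta>. is_base D \<Delta> C \<longrightarrow> upp_closure D \<Delta> = C)"

definition affine_op :: "nat \<Rightarrow> nat list \<Rightarrow> nat" where
  "affine_op p t = nat ((int (t ! 0) - int (t ! 1) + int (t ! 2)) mod int p)"

end

theory Submission
  imports Defs "HOL-Number_Theory.Cong"
begin

text \<open>
  The solution set of a conjunction over a base is closed under \<open>x - y + z\<close>, so adding multiples of
  the difference of two solutions with the same free part to a third solution gives solutions again.
  Since \<open>p\<close> is prime, an existential variable that is not determined by the free variables
  therefore takes every value of \<open>D\<close> above every tuple of the defined relation. Hence requiring it
  to equal \<open>x\<^sub>1\<close> does not change that relation, and doing this for all undetermined variables
  yields a upp-definition. A nonempty relation of arity \<open>0\<close>, where there is no \<open>x\<^sub>1\<close>, is defined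
  by the empty conjunction.
\<close>

declare nlistsE_length [simp del] nlistsE_set [simp del]

section \<open>Combining satisfying assignments coordinatewise\<close>

definition affine_comb :: "nat \<Rightarrow> nat list \<Rightarrow> nat list \<Rightarrow> nat list \<Rightarrow> nat list" where
  "affine_comb p a b c = map (\<lambda>i. affine_op p [a ! i, b ! i, c ! i]) [0..<length a]"

lemma length_affine_comb [simp]: "length (affine_comb p a b c) = length a"
  by (simp add: affine_comb_def)

lemma nth_affine_comb:
  "i < length a \<Longrightarrow> affine_comb p a b c ! i = affine_op p [a ! i, b ! i, c ! i]"
  by (simp add: affine_comb_def)

lemma int_affine_op:
  "p > 0 \<Longrightarrow> int (affine_op p [a, b, c]) = (int a - int b + int c) mod int p"
  by (simp add: affine_op_def)

lemma affine_op_less: "p > 0 \<Longrightarrow> affine_op p t < p"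
  by (simp add: affine_op_def nat_less_iff)

lemma affine_op_cancel: "a < p \<Longrightarrow> affine_op p [a, b, b] = a"
  by (simp add: affine_op_def)

lemma affine_comb_in_nlists:
  "p > 0 \<Longrightarrow> length a = N \<Longrightarrow> affine_comb p a b c \<in> nlists N {0..<p}"
  by (auto simp: nlists_def affine_comb_def affine_op_less)

text \<open>Atoms may use the equality relation even when it is not in the base, so its preservation
  has to be supplied separately. Tuples with two equal entries are combined to such a tuple
  again.\<close>

lemma preserves_affine_op_Eq_rel:
  assumes "p > 0"
  shows "preserves 3 (affine_op p) (Eq_rel {0..<p})"
  unfolding preserves_def
proof
  fix ts assume ts: "ts \<in> nlists 3 (snd (Eq_rel {0..<p}))"
  then obtain t1 t2 t3 where "ts = [t1, t2, t3]"
    by (auto simp: nlists_def numeral_3_eq_3 length_Suc_conv)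
  with ts show "map (\<lambda>i. affine_op p (map (\<lambda>t. t ! i) ts)) [0..<fst (Eq_rel {0..<p})]
      \<in> snd (Eq_rel {0..<p})"
    using assms by (auto simp: Eq_rel_def nlists_def numeral_2_eq_2 affine_op_less)
qed

text \<open>Reading off the variables of an atom commutes with applying the operation
  coordinatewise. Each atom therefore only asks that its relation contain the combination of three
  of its own tuples, which is preservation.\<close>

lemma satisfies_affine_comb:
  assumes "p > 0" and \<phi>: "conj_over {0..<p} \<Delta> N \<phi>"
    and \<Delta>: "\<And>r. r \<in> \<Delta> \<Longrightarrow> preserves 3 (affine_op p) r"
    and len: "length a = N"
    and sat: "satisfies a \<phi>" "satisfies b \<phi>" "satisfies c \<phi>"
  shows "satisfies (affine_comb p a b c) \<phi>"
  unfolding satisfies_def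
proof clarify
  fix k R vs assume in\<phi>: "((k, R), vs) \<in> set \<phi>"
  have vs: "length vs = k" "set vs \<subseteq> {..<N}" and "(k, R) \<in> \<Delta> \<union> {Eq_rel {0..<p}}"
    using bspec[OF \<phi>[unfolded conj_over_def] in\<phi>] by auto
  then have pres: "preserves 3 (affine_op p) (k, R)"
    using \<Delta> preserves_affine_op_Eq_rel[OF \<open>p > 0\<close>] by auto
  have R: "map ((!) a) vs \<in> R" "map ((!) b) vs \<in> R" "map ((!) c) vs \<in> R"
    using sat in\<phi> by (auto simp: satisfies_def)
  let ?ts = "[map ((!) a) vs, map ((!) b) vs, map ((!) c) vs]"
  have "?ts \<in> nlists 3 R" using R by (auto simp: nlists_def)
  then have "map (\<lambda>i. affine_op p (map (\<lambda>t. t ! i) ?ts)) [0..<k] \<in> R"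
    using pres[unfolded preserves_def, THEN bspec, of ?ts] by simp
  moreover have "map (\<lambda>i. affine_op p (map (\<lambda>t. t ! i) ?ts)) [0..<k]
      = map ((!) (affine_comb p a b c)) vs"
  proof (rule nth_equalityI)
    fix i assume "i < length (map (\<lambda>i. affine_op p (map (\<lambda>t. t ! i) ?ts)) [0..<k])"
    then have "i < length vs" using vs by simp
    moreover from this have "vs ! i < length a" using vs len nth_mem by fastforce
    ultimately show "map (\<lambda>i. affine_op p (map (\<lambda>t. t ! i) ?ts)) [0..<k] ! i
        = map ((!) (affine_comb p a b c)) vs ! i"
      using vs by (simp add: nth_affine_comb)
  qed (use vs in simp)
  ultimately show "map ((!) (affine_comb p a b c)) vs \<in> snd (k, R)" by simp
qed

section \<open>Undetermined variables and how to pin them down\<close>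

lemma arithmetic_progression_mod_prime:
  fixes y d t p :: int
  assumes "prime p" "\<not> p dvd d"
  shows "\<exists>k::nat. [y + int k * d = t] (mod p)"
proof -
  have "coprime d p" using assms by (metis coprime_commute prime_imp_coprime)
  then obtain e where e: "[d * e = 1] (mod p)" using cong_solve_coprime_int by blast
  \<comment> \<open>With \<open>e\<close> the inverse of \<open>d\<close> modulo \<open>p\<close>,
    this solves \<open>y + k * d = t\<close> for \<open>k\<close>; taking the residue makes the
    solution a natural number.\<close>
  define k where "k = nat (((t - y) * e) mod p)"
  have "p > 0" using assms prime_gt_0_int by blast
  then have "int k = ((t - y) * e) mod p" by (simp add: k_def)
  then have "[int k = (t - y) * e] (mod p)" by (simp add: cong_def)
  then have "[y + int k * d = y + (t - y) * e * d] (mod p)"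
    by (intro cong_add cong_mult) auto
  also have "y + (t - y) * e * d = y + (t - y) * (d * e)" by (simp add: algebra_simps)
  also have "[\<dots> = y + (t - y) * 1] (mod p)" using e by (intro cong_add cong_mult) auto
  finally show ?thesis by auto
qed

text \<open>Uniqueness is phrased by comparing two solutions rather than by a function
  \<open>h\<close>: the negation then directly yields two solutions with the same free part that
  differ at \<open>j\<close>.\<close>

definition determined :: "'a set \<Rightarrow> nat \<Rightarrow> nat \<Rightarrow> 'a atom list \<Rightarrow> nat \<Rightarrow> bool" where
  "determined D n m \<phi> j \<longleftrightarrow>
     (\<forall>xs \<in> nlists n D. \<forall>ys \<in> nlists m D. \<forall>zs \<in> nlists m D.
        satisfies (xs @ ys) \<phi> \<longrightarrow> satisfies (xs @ zs) \<phi> \<longrightarrow> ys ! j = zs ! j)"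

text \<open>The two solutions that differ at \<open>j\<close> may lie above a tuple other than
  \<open>xs\<close>. Only their difference matters, and the affine operation carries it over to
  \<open>xs\<close>. The other quantified variables may change along the way.\<close>

lemma not_determined_takes_all_values:
  assumes p: "prime p" and \<phi>: "conj_over {0..<p} \<Delta> (n + m) \<phi>"
    and \<Delta>: "\<And>r. r \<in> \<Delta> \<Longrightarrow> preserves 3 (affine_op p) r"
    and j: "j < m" and nd: "\<not> determined {0..<p} n m \<phi> j"
    and xs: "xs \<in> nlists n {0..<p}" and ys: "ys \<in> nlists m {0..<p}"
    and sat: "satisfies (xs @ ys) \<phi>" and t: "t < p"
  shows "\<exists>ws \<in> nlists m {0..<p}. satisfies (xs @ ws) \<phi> \<and> ws ! j = t"
proof -
  have p0: "p > 0" using p prime_gt_0_nat by blast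
  obtain us vs zs where u: "us \<in> nlists n {0..<p}" and v: "vs \<in> nlists m {0..<p}"
    and z: "zs \<in> nlists m {0..<p}" and satv: "satisfies (us @ vs) \<phi>"
    and satz: "satisfies (us @ zs) \<phi>" and ne: "vs ! j \<noteq> zs ! j"
    using nd unfolding determined_def by blast
  define d where "d = int (zs ! j) - int (vs ! j)"
  have len: "length xs = n" "length us = n" "length ys = m" "length vs = m" "length zs = m"
    using xs u ys v z by (auto simp: nlists_def)
  have lt: "vs ! j < p" "zs ! j < p"
    using nlistsE_nth_in[OF v j] nlistsE_nth_in[OF z j] by auto
  have nd: "\<not> int p dvd d"
  proof
    assume "int p dvd d"
    moreover have "\<bar>d\<bar> < int p" "d \<noteq> 0" using lt ne by (auto simp: d_def)
    ultimately show False using zdvd_imp_le[of "int p" "\<bar>d\<bar>"] by simp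
  qed
  have step: "\<exists>ws \<in> nlists m {0..<p}. satisfies (xs @ ws) \<phi>
      \<and> [int (ws ! j) = int (ys ! j) + int k * d] (mod int p)" for k
  proof (induction k)
    case 0
    then show ?case using ys sat by auto
  next
    case (Suc k)
    then obtain ws where ws: "ws \<in> nlists m {0..<p}" "satisfies (xs @ ws) \<phi>"
      and c: "[int (ws ! j) = int (ys ! j) + int k * d] (mod int p)" by auto
    have lw: "length ws = m" using ws by (simp add: nlists_def)
    \<comment> \<open>On the free coordinates this is \<open>xs - us + us\<close>, hence
      \<open>xs\<close>, whose entries are already reduced modulo \<open>p\<close>. On the
      quantified ones it is \<open>ws - vs + zs\<close>, which shifts coordinate \<open>j\<close> by
      \<open>d\<close>.\<close>
    let ?s = "affine_comb p (xs @ ws) (us @ vs) (us @ zs)"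
    let ?w = "affine_comb p ws vs zs"
    have "?s = xs @ ?w"
    proof (rule nth_equalityI)
      fix i assume i: "i < length ?s"
      show "?s ! i = (xs @ ?w) ! i"
      proof (cases "i < n")
        case True
        then have "xs ! i < p" using nlistsE_nth_in[OF xs] by simp
        then show ?thesis using True i len lw
          by (simp add: nth_affine_comb nth_append affine_op_cancel)
      next
        case False
        then show ?thesis using i len lw by (simp add: nth_affine_comb nth_append)
      qed
    qed (simp add: len lw)
    moreover have "satisfies ?s \<phi>"
      by (rule satisfies_affine_comb[OF p0 \<phi> \<Delta>]) (use len lw ws satv satz in auto)
    ultimately have "satisfies (xs @ ?w) \<phi>" by simp
    moreover have "?w \<in> nlists m {0..<p}" using affine_comb_in_nlists p0 lw by blast
    moreover have "[int (?w ! j) = int (ys ! j) + int (Suc k) * d] (mod int p)"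
    proof -
      have "int (?w ! j) = (int (ws ! j) + d) mod int p"
        using j lw p0 by (simp add: nth_affine_comb int_affine_op d_def algebra_simps)
      then have "[int (?w ! j) = int (ws ! j) + d] (mod int p)" by (simp add: cong_def)
      also have "[int (ws ! j) + d = int (ys ! j) + int k * d + d] (mod int p)"
        using c by (intro cong_add) auto
      also have "int (ys ! j) + int k * d + d = int (ys ! j) + int (Suc k) * d"
        by (simp add: algebra_simps)
      finally show ?thesis .
    qed
    ultimately show ?case by blast
  qed
  obtain k where k: "[int (ys ! j) + int k * d = int t] (mod int p)"
    using arithmetic_progression_mod_prime[of "int p" d] p nd by auto
  obtain ws where ws: "ws \<in> nlists m {0..<p}" "satisfies (xs @ ws) \<phi>"
    and c: "[int (ws ! j) = int (ys ! j) + int k * d] (mod int p)" using step by blast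
  have "[int (ws ! j) = int t] (mod int p)" using c k cong_trans by blast
  then have "[ws ! j = t] (mod p)" by (simp add: cong_int_iff)
  moreover have "ws ! j < p" using nlistsE_nth_in[OF ws(1) j] by simp
  ultimately have "ws ! j = t" using t by (simp add: cong_def)
  then show ?thesis using ws by blast
qed

text \<open>The variables are treated one at a time, and whether the next one is determined is
  tested for the current conjunction, not the original one. An added atom can only remove solutions,
  so variables that are determined stay so.\<close>

lemma pp_definition_determined:
  assumes p: "prime p" and n: "fst r > 0"
    and \<Delta>: "\<And>r. r \<in> \<Delta> \<Longrightarrow> preserves 3 (affine_op p) r"
    and pp: "pp_definition {0..<p} \<Delta> r m \<phi>" and "k \<le> m"
  shows "\<exists>\<psi>. pp_definition {0..<p} \<Delta> r m \<psi> \<and> (\<forall>j<k. determined {0..<p} (fst r) m \<psi> j)"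
  using \<open>k \<le> m\<close>
proof (induction k)
  case 0
  then show ?case using pp by auto
next
  case (Suc k)
  define n where "n = fst r"
  obtain \<psi> where \<psi>: "pp_definition {0..<p} \<Delta> r m \<psi>"
    and det: "\<And>j. j < k \<Longrightarrow> determined {0..<p} n m \<psi> j"
    using Suc by (auto simp: n_def)
  have n0: "n > 0" and k: "k < m" using n Suc.prems by (auto simp: n_def)
  have co: "conj_over {0..<p} \<Delta> (n + m) \<psi>" using \<psi> by (simp add: pp_definition_def n_def)
  show ?case
  proof (cases "determined {0..<p} n m \<psi> k")
    case True
    then show ?thesis using \<psi> det by (auto simp: less_Suc_eq n_def)
  next
    case False
    \<comment> \<open>Variable \<open>0\<close> is the first free variable, available because
      \<open>n > 0\<close>; variable \<open>n + k\<close> is the quantified variable at position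
      \<open>k\<close>, counted from zero.\<close>
    define \<chi> where "\<chi> = (Eq_rel {0..<p}, [0, n + k]) # \<psi>"
    have sat: "satisfies (xs @ ys) \<chi> \<longleftrightarrow> satisfies (xs @ ys) \<psi> \<and> ys ! k = xs ! 0"
      if "xs \<in> nlists n {0..<p}" "ys \<in> nlists m {0..<p}" for xs ys
    proof -
      have "length xs = n" using that by (simp add: nlists_def)
      moreover have "xs ! 0 < p" using nlistsE_nth_in[OF that(1) n0] by simp
      ultimately show ?thesis using n0
        by (auto simp: \<chi>_def satisfies_def Eq_rel_def nth_append)
    qed
    have "conj_over {0..<p} \<Delta> (n + m) \<chi>"
      using co n0 k by (auto simp: conj_over_def \<chi>_def Eq_rel_def)
    moreover have "(\<exists>ys \<in> nlists m {0..<p}. satisfies (xs @ ys) \<psi>)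
        \<longleftrightarrow> (\<exists>ys \<in> nlists m {0..<p}. satisfies (xs @ ys) \<chi>)"
      if xs: "xs \<in> nlists n {0..<p}" for xs
    proof
      assume "\<exists>ys \<in> nlists m {0..<p}. satisfies (xs @ ys) \<psi>"
      then obtain ys where ys: "ys \<in> nlists m {0..<p}" "satisfies (xs @ ys) \<psi>" by blast
      have "xs ! 0 < p" using nlistsE_nth_in[OF xs n0] by simp
      \<comment> \<open>The value prescribed for the undetermined variable is \<open>xs ! 0\<close>,
        so the solution obtained also satisfies the new equality.\<close>
      from not_determined_takes_all_values[OF p co \<Delta> k False xs ys this]
      show "\<exists>ys \<in> nlists m {0..<p}. satisfies (xs @ ys) \<chi>" using sat xs by blast
    qed (use sat xs in blast)
    ultimately have "pp_definition {0..<p} \<Delta> r m \<chi>"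
      using \<psi> by (auto simp: pp_definition_def n_def)
    moreover have "determined {0..<p} n m \<chi> j" if "j < Suc k" for j
    proof (cases "j = k")
      case True
      then show ?thesis using sat by (simp add: determined_def)
    next
      case False
      with that have "determined {0..<p} n m \<psi> j" using det by simp
      then show ?thesis unfolding determined_def using sat by blast
    qed
    ultimately show ?thesis by (auto simp: n_def)
  qed
qed

section \<open>From determined variables to upp-definitions\<close>

lemma upp_definitionI:
  assumes pp: "pp_definition D \<Delta> r m \<phi>" and "D \<noteq> {}"
    and det: "\<And>j. j < m \<Longrightarrow> determined D (fst r) m \<phi> j"
  shows "upp_definition D \<Delta> r m \<phi>"
  unfolding upp_definition_def
proof (intro conjI allI impI pp)
  fix j assume j: "j < m"
  obtain d where d: "d \<in> D" using \<open>D \<noteq> {}\<close> by blast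
  define P where "P xs ys \<longleftrightarrow> ys \<in> nlists m D \<and> satisfies (xs @ ys) \<phi>" for xs ys
  \<comment> \<open>The function takes coordinate \<open>j\<close> of an arbitrarily chosen solution
    above \<open>xs\<close>; determinacy makes the choice harmless. The default \<open>d\<close>
    serves tuples without a solution and keeps the values in \<open>D\<close>.\<close>
  define h where "h xs = (if \<exists>ys. P xs ys then (SOME ys. P xs ys) ! j else d)" for xs
  have some: "P xs (SOME ys. P xs ys)" if "P xs ys" for xs ys using that by (rule someI)
  have "h \<in> nlists (fst r) D \<rightarrow> D"
  proof
    fix xs
    show "h xs \<in> D"
    proof (cases "\<exists>ys. P xs ys")
      case True
      then have "(SOME ys. P xs ys) \<in> nlists m D" using some P_def by blast
      then show ?thesis using True nlistsE_nth_in[OF _ j] by (simp add: h_def)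
    qed (simp add: h_def d)
  qed
  moreover have "ys ! j = h xs" if "xs \<in> nlists (fst r) D" "ys \<in> nlists m D"
    "satisfies (xs @ ys) \<phi>" for xs ys
  proof -
    have P: "P xs ys" using that by (simp add: P_def)
    have "ys ! j = (SOME ys. P xs ys) ! j"
      using det[OF j] some[OF P] that unfolding determined_def P_def by blast
    then show ?thesis using P by (auto simp: h_def)
  qed
  ultimately show "\<exists>h \<in> nlists (fst r) D \<rightarrow> D. \<forall>xs \<in> nlists (fst r) D. \<forall>ys \<in> nlists m D.
      satisfies (xs @ ys) \<phi> \<longrightarrow> ys ! j = h xs"
    by blast
qed

lemma relations_subset_pp_closure:
  assumes "\<Delta> \<subseteq> relations D"
  shows "\<Delta> \<subseteq> pp_closure D \<Delta>"
proof
  fix r assume r: "r \<in> \<Delta>"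
  then have sub: "snd r \<subseteq> nlists (fst r) D" using assms by (cases r) (auto simp: relations_def)
  have "map ((!) xs) [0..<fst r] = xs" if "xs \<in> nlists (fst r) D" for xs
    using that map_nth[of xs] by (simp add: nlists_def)
  \<comment> \<open>The single atom lists the free variables in their order, with nothing
    quantified, so it defines \<open>r\<close> itself.\<close>
  then have "pp_definition D \<Delta> r 0 [(r, [0..<fst r])]"
    using r sub by (auto simp: pp_definition_def conj_over_def satisfies_def nlists_def)
  then show "r \<in> pp_closure D \<Delta>" by (auto simp: pp_closure_def)
qed

lemma upp_closure_eq_pp_closure:
  assumes p: "prime p" and \<Delta>: "\<And>r. r \<in> \<Delta> \<Longrightarrow> preserves 3 (affine_op p) r"
  shows "upp_closure {0..<p} \<Delta> = pp_closure {0..<p} \<Delta>"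
proof
  show "upp_closure {0..<p} \<Delta> \<subseteq> pp_closure {0..<p} \<Delta>"
    by (auto simp: upp_closure_def pp_closure_def upp_definition_def)
  show "pp_closure {0..<p} \<Delta> \<subseteq> upp_closure {0..<p} \<Delta>"
  proof
    fix r assume "r \<in> pp_closure {0..<p} \<Delta>"
    then obtain m \<phi> where pp: "pp_definition {0..<p} \<Delta> r m \<phi>" by (auto simp: pp_closure_def)
    have ne: "{0..<p} \<noteq> {}" using p prime_gt_0_nat by auto
    have "\<exists>m \<phi>. pp_definition {0..<p} \<Delta> r m \<phi> \<and> (\<forall>j<m. determined {0..<p} (fst r) m \<phi> j)"
    proof (cases "fst r = 0")
      case False
      then show ?thesis using pp_definition_determined[OF p _ \<Delta> pp order_refl] by blast
    next
      case True
      show ?thesis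
      proof (cases "snd r = {}")
        case empty: True
        \<comment> \<open>If \<open>r\<close> is empty, \<phi> has no satisfying assignment over the
          domain, so every variable is determined vacuously.\<close>
        then have "determined {0..<p} (fst r) m \<phi> j" for j
          using pp by (auto simp: pp_definition_def determined_def)
        then show ?thesis using pp by blast
      next
        case False
        then have "snd r = {[]}" using pp True by (auto simp: pp_definition_def)
        then have "pp_definition {0..<p} \<Delta> r 0 []"
          using True by (simp add: pp_definition_def conj_over_def satisfies_def)
        then show ?thesis by auto
      qed
    qed
    then show "r \<in> upp_closure {0..<p} \<Delta>"
      using upp_definitionI[OF _ ne] unfolding upp_closure_def by blast
  qed
qed

theorem theorem15:
  fixes p :: nat and D :: "nat set" and \<Gamma> :: "nat nrel set"
  assumes "prime p"
    and "D = {0..<p}"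
    and "\<Gamma> \<subseteq> relations D"
    and "pp_closure D \<Gamma> \<subseteq> Inv D 3 (affine_op p)"
  shows "uniquely_covered D (pp_closure D \<Gamma>)"
  unfolding uniquely_covered_def
proof (intro conjI allI impI)
  show "co_clone D (pp_closure D \<Gamma>)" using assms(3) by (auto simp: co_clone_def)
  fix \<Delta> assume "is_base D \<Delta> (pp_closure D \<Gamma>)"
  then have \<Delta>: "\<Delta> \<subseteq> relations D" "pp_closure D \<Delta> = pp_closure D \<Gamma>"
    by (auto simp: is_base_def)
  \<comment> \<open>The hypothesis on the co-clone passes to every base of it, since a base lies
    inside the co-clone that it generates.\<close>
  then have "\<Delta> \<subseteq> Inv D 3 (affine_op p)" using relations_subset_pp_closure assms(4) by blast
  then show "upp_closure D \<Delta> = pp_closure D \<Gamma>"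
    using upp_closure_eq_pp_closure[OF assms(1)] \<Delta>(2) assms(2) by (auto simp: Inv_def)
qed

end
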